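(* Let $1<\alpha<5/4$ be irrational and let $\beta$ satisfy $1/\alpha+1/\beta=1$. If the modified 2-pile subtraction game is played with the Beatty constraint function parameterized by $\alpha$, then its set of $P$-positions is $\{([n\alpha],[n\beta])\mid n\in\mathbb{Z}_{\ge0}\}$.
   Context: $[\cdot]$ denotes the floor function. Beatty constraint function: for irrational $1<\alpha<2$ and $\beta$ with $1/\alpha+1/\beta=1$, the sequences $([n\alpha])_{n\ge1}$ and $([n\beta])_{n\ge 1}$ partition the positive integers, and the Beatty constraint function parameterized by $\alpha$ is defined on positive integers by $$f([n\alpha])=f([n\beta])=([n\beta]-[(n-1)\beta])-([n\alpha]-[(n-1)\alpha]),\qquad n\ge 1.$$ Modified 2-pile subtraction game with integer-valued constraint function $f$ depending only on $x_0$: a position consists of two piles of tokens and is written $(x,y)$ with $0\le x\le y<\infty$ (the smaller pile is always listed first). Two players alternate; on each turn the player does one of the following. (aa) Remove any positive number of tokens from a single pile, possibly the entire pile. (bb) Remove a positive number of tokens from each pile, moving from $(x_0,y_0)$ to $(x_1,y_1)$ (so $0\le x_1<x_0$, $0\le y_1<y_0$), where $|(y_0-y_1)-(x_0-x_1)|<f(x_0)$. The player who leaves both piles empty wins (normal play). A position is an $N$-position if the player moving from it has a winning strategy, and a $P$-position otherwise. *)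

theory Defs
  imports Complex_Main
begin

text \<open>A position lists the smaller pile first.\<close>

type_synonym pos = "nat \<times> nat"

definition is_position :: "pos \<Rightarrow> bool" where
  "is_position p \<longleftrightarrow> fst p \<le> snd p"

definition listed :: "nat \<Rightarrow> nat \<Rightarrow> pos" where
  "listed a b = (min a b, max a b)"

text \<open>
  In \<open>both\<close> the pair moved to is itself a position, so \<open>x1 \<le> y1\<close>. A removal from both piles
  that reverses their order gives nothing new; see \<open>move_remove_both\<close> below.
\<close>

inductive move :: "(nat \<Rightarrow> int) \<Rightarrow> pos \<Rightarrow> pos \<Rightarrow> bool" for f :: "nat \<Rightarrow> int" where
  smaller: "\<lbrakk>x \<le> y; 0 < k; k \<le> x\<rbrakk> \<Longrightarrow> move f (x, y) (listed (x - k) y)"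
| larger: "\<lbrakk>x \<le> y; 0 < k; k \<le> y\<rbrakk> \<Longrightarrow> move f (x, y) (listed x (y - k))"
| both: "\<lbrakk>x0 \<le> y0; x1 \<le> y1; x1 < x0; y1 < y0;
          \<bar>(int y0 - int y1) - (int x0 - int x1)\<bar> < f x0\<rbrakk>
         \<Longrightarrow> move f (x0, y0) (x1, y1)"

lemma move_is_position: "move f p q \<Longrightarrow> is_position p \<and> is_position q"
  by (induction rule: move.induct) (auto simp: is_position_def listed_def)

lemma move_remove_both:
  assumes "x \<le> y" "0 < k" "k \<le> x" "0 < l" "l \<le> y" "\<bar>int l - int k\<bar> < f x"
  shows "move f (x, y) (listed (x - k) (y - l))"
proof (cases "x - k \<le> y - l")
  case True
  then have "move f (x, y) (x - k, y - l)"
    using assms by (intro move.both) auto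
  then show ?thesis
    using True by (simp add: listed_def)
next
  case False
  then have "move f (x, y) (y - l, x - k)"
    using assms by (intro move.both) auto
  then show ?thesis
    using False by (simp add: listed_def)
qed

text \<open>
  \<open>winning_strategy f s p\<close>: the player to move from \<open>p\<close>, always moving from a position \<open>q\<close> to
  \<open>s q\<close>, is the one who leaves both piles empty, whatever the opponent does. It does not hold
  at \<open>(0, 0)\<close>, which has no moves, so the opponent must not be able to empty both piles.
\<close>

inductive winning_strategy :: "(nat \<Rightarrow> int) \<Rightarrow> (pos \<Rightarrow> pos) \<Rightarrow> pos \<Rightarrow> bool"
  for f :: "nat \<Rightarrow> int" and s :: "pos \<Rightarrow> pos" where
  finish: "\<lbrakk>move f p (s p); s p = (0, 0)\<rbrakk> \<Longrightarrow> winning_strategy f s p"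
| continue: "\<lbrakk>move f p (s p); s p \<noteq> (0, 0); \<forall>q. move f (s p) q \<longrightarrow> winning_strategy f s q\<rbrakk>
             \<Longrightarrow> winning_strategy f s p"

definition N_position :: "(nat \<Rightarrow> int) \<Rightarrow> pos \<Rightarrow> bool" where
  "N_position f p \<longleftrightarrow> is_position p \<and> (\<exists>s. winning_strategy f s p)"

definition P_position :: "(nat \<Rightarrow> int) \<Rightarrow> pos \<Rightarrow> bool" where
  "P_position f p \<longleftrightarrow> is_position p \<and> \<not> N_position f p"

text \<open>
  For irrational \<open>1 < \<alpha> < 2\<close> and \<open>1 / \<alpha> + 1 / \<beta> = 1\<close>, each positive \<open>m\<close> has exactly one of the
  forms \<open>\<lfloor>n * \<alpha>\<rfloor>\<close>, \<open>\<lfloor>n * \<beta>\<rfloor>\<close> for exactly one \<open>n \<ge> 1\<close> (Beatty), so the description is proper.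
  The value at 0 is irrelevant: no move from \<open>(0, y)\<close> takes from both piles.
\<close>

definition beatty_constraint :: "real \<Rightarrow> real \<Rightarrow> nat \<Rightarrow> int" where
  "beatty_constraint \<alpha> \<beta> m =
    (THE v. \<exists>n::nat. n \<ge> 1 \<and> (int m = \<lfloor>real n * \<alpha>\<rfloor> \<or> int m = \<lfloor>real n * \<beta>\<rfloor>) \<and>
       v = (\<lfloor>real n * \<beta>\<rfloor> - \<lfloor>(real n - 1) * \<beta>\<rfloor>) - (\<lfloor>real n * \<alpha>\<rfloor> - \<lfloor>(real n - 1) * \<alpha>\<rfloor>))"

end

theory Submission
  imports Defs
begin

text \<open>
  Write \<open>a n\<close>, \<open>b n\<close> for the floors of \<open>n * \<alpha>\<close>, \<open>n * \<beta>\<close> and \<open>d n = b n - a n\<close>. The set \<open>S\<close> of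
  the pairs \<open>(a n, b n)\<close> is a kernel of the game: no move joins two members of \<open>S\<close>, and every
  position outside \<open>S\<close> has a move into \<open>S\<close>. A kernel of a terminating game is its set of
  P-positions (\<open>P_positions_eq_kernel\<close>).

  No move joins two members. By Beatty's theorem different members of \<open>S\<close> share no number, which
  excludes moves on one pile. A move on both piles from \<open>(a n, b n)\<close> to \<open>(a m, b m)\<close> changes the
  difference of the piles by \<open>d n - d m \<ge> d n - d (n - 1)\<close>, and the right-hand side is exactly the
  value \<open>f (a n)\<close> of the constraint function.

  Every other position \<open>(x, y)\<close> has a move into \<open>S\<close>. If \<open>x = b n\<close>, or \<open>x = a n\<close> and \<open>y > b n\<close>, it
  suffices to lower \<open>y\<close>; by Beatty's theorem there remains only \<open>x = a n\<close> and \<open>y < b n\<close>. Choose \<open>m < n\<close> with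
  \<open>d m \<le> y - x < d (m + 1)\<close>; the move to \<open>(a m, b m)\<close> succeeds when \<open>y - x - d m < f x\<close>. Otherwise,
  since all gaps of \<open>b\<close> agree up to \<open>1\<close> and those of \<open>a\<close> are \<open>1\<close> or \<open>2\<close>, the difference \<open>y - x\<close>
  falls short of \<open>d (m + 1)\<close> by at most \<open>a n - a (n - 1) \<le> 2\<close>. This makes \<open>(a (m + 1), b (m + 1))\<close>
  reachable: either \<open>y = b (m + 1)\<close> and it is enough to lower \<open>x\<close>, or both piles shrink and
  the difference changes by at most \<open>2 < f x\<close>. The last inequality is where \<open>\<alpha> < 5 / 4\<close> enters:
  it gives \<open>\<beta> > 5\<close> and hence \<open>f x \<ge> 5 - 2\<close>.
\<close>

section \<open>Kernels and P-positions\<close>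

lemma move_decreases: "move f p q \<Longrightarrow> fst q + snd q < fst p + snd p"
  by (induction rule: move.induct) (auto simp: listed_def)

text \<open>
  The player to move outside a kernel always moves into it; since the number of tokens decreases
  and the empty position can only belong to the kernel, this player eventually empties both piles.
  Conversely, no strategy wins from the kernel: its first move leaves the kernel, the opponent can
  move back into it, and by induction the strategy does not win from there.
\<close>

lemma P_positions_eq_kernel:
  assumes positions: "\<And>p. p \<in> S \<Longrightarrow> is_position p"
    and independent: "\<And>p q. p \<in> S \<Longrightarrow> move f p q \<Longrightarrow> q \<notin> S"
    and absorbing: "\<And>p. is_position p \<Longrightarrow> p \<notin> S \<Longrightarrow> \<exists>q\<in>S. move f p q"
  shows "{p. P_position f p} = S"
proof -
  have empty_stuck: "\<not> move f (0, 0) q" for q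
    using move_decreases[of f "(0, 0)" q] by auto
  then have empty_in: "(0, 0) \<in> S"
    using absorbing[of "(0, 0)"] by (auto simp: is_position_def)
  define s where "s p = (SOME q. q \<in> S \<and> move f p q)" for p
  have s: "s p \<in> S" "move f p (s p)" if "is_position p" "p \<notin> S" for p
    using someI_ex[of "\<lambda>q. q \<in> S \<and> move f p q"] absorbing[OF that] unfolding s_def by auto
  have won: "winning_strategy f s p" if "is_position p" "p \<notin> S" for p
    using that
  proof (induction "fst p + snd p" arbitrary: p rule: less_induct)
    case less
    show ?case
    proof (cases "s p = (0, 0)")
      case True
      then show ?thesis using s(2)[OF less.prems] by (rule winning_strategy.finish[rotated])
    next
      case False
      have "winning_strategy f s q" if "move f (s p) q" for q
      proof (rule less.hyps)
        show "fst q + snd q < fst p + snd p"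
          using move_decreases[OF that] move_decreases[OF s(2)[OF less.prems]] by simp
        show "is_position q" using move_is_position[OF that] by simp
        show "q \<notin> S" using independent[OF s(1)[OF less.prems] that] .
      qed
      then show ?thesis using s(2)[OF less.prems] False by (intro winning_strategy.continue) auto
    qed
  qed
  have lost: "p \<notin> S" if "winning_strategy f t p" for t p
    using that
  proof induction
    case (finish p)
    then show ?case using independent empty_in by metis
  next
    case (continue p)
    then have "t p \<in> S"
      using absorbing[of "t p"] move_is_position by blast
    then show ?case using independent continue by blast
  qed
  show ?thesis
    using won lost positions unfolding P_position_def N_position_def by blast
qed

section \<open>Beatty sequences\<close>

lemma irrational_multiple_neq_int:
  fixes x :: real
  assumes "x \<notin> \<rat>" "n \<ge> 1"
  shows "real n * x \<noteq> of_int k"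
proof
  assume "real n * x = of_int k"
  then have "x = of_int k / real n" using assms(2) by (simp add: field_simps)
  then show False using assms(1) by simp
qed

lemma floor_multiple_step:
  fixes x :: real
  shows "\<lfloor>x\<rfloor> \<le> \<lfloor>real (Suc n) * x\<rfloor> - \<lfloor>real n * x\<rfloor>"
    and "\<lfloor>real (Suc n) * x\<rfloor> - \<lfloor>real n * x\<rfloor> \<le> \<lfloor>x\<rfloor> + 1"
proof -
  have "real (Suc n) * x = real n * x + x" by (simp add: algebra_simps)
  then show "\<lfloor>x\<rfloor> \<le> \<lfloor>real (Suc n) * x\<rfloor> - \<lfloor>real n * x\<rfloor>"
    and "\<lfloor>real (Suc n) * x\<rfloor> - \<lfloor>real n * x\<rfloor> \<le> \<lfloor>x\<rfloor> + 1"
    by linarith+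
qed

text \<open>
  If both sequences took the value \<open>m\<close>, at \<open>n\<close> and \<open>k\<close>, irrationality would make
  \<open>m / \<alpha> < n < (m + 1) / \<alpha>\<close> and \<open>m / \<beta> < k < (m + 1) / \<beta>\<close> strict, and adding them would put the
  integer \<open>n + k\<close> strictly between \<open>m\<close> and \<open>m + 1\<close>.
\<close>

lemma beatty_disjoint:
  fixes \<alpha> \<beta> :: real
  assumes "0 < \<alpha>" "0 < \<beta>" "\<alpha> \<notin> \<rat>" "\<beta> \<notin> \<rat>" "1 / \<alpha> + 1 / \<beta> = 1" "n \<ge> 1" "k \<ge> 1"
  shows "\<lfloor>real n * \<alpha>\<rfloor> \<noteq> \<lfloor>real k * \<beta>\<rfloor>"
proof
  assume eq: "\<lfloor>real n * \<alpha>\<rfloor> = \<lfloor>real k * \<beta>\<rfloor>"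
  define m where "m = \<lfloor>real n * \<alpha>\<rfloor>"
  have "m < real n * \<alpha>" "real n * \<alpha> < m + 1" "m < real k * \<beta>" "real k * \<beta> < m + 1"
    using irrational_multiple_neq_int[OF assms(3,6), of m]
      irrational_multiple_neq_int[OF assms(4,7), of m] eq m_def by linarith+
  then have "m * (1 / \<alpha>) < n" "n < (m + 1) * (1 / \<alpha>)" "m * (1 / \<beta>) < k" "k < (m + 1) * (1 / \<beta>)"
    using assms(1,2) by (simp_all add: field_simps)
  then have "m * (1 / \<alpha> + 1 / \<beta>) < real n + real k" "real n + real k < (m + 1) * (1 / \<alpha> + 1 / \<beta>)"
    by (simp_all only: distrib_left)
  then have "real_of_int m < real_of_int (int n + int k)"
    "real_of_int (int n + int k) < real_of_int (m + 1)"
    unfolding assms(5) by simp_all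
  then show False unfolding of_int_less_iff by linarith
qed

text \<open>
  If \<open>m\<close> is missed by both sequences, let \<open>n\<close> and \<open>k\<close> be the last indices at which they lie below
  \<open>m\<close>. The next terms exceed \<open>m + 1\<close>. Dividing by \<open>\<alpha>\<close> and \<open>\<beta>\<close> and adding gives \<open>n + k < m\<close> and
  \<open>m + 1 < (n + 1) + (k + 1)\<close>, which leaves no integer for \<open>n + k\<close>. Irrationality keeps the next
  terms away from \<open>m + 1\<close> itself, where the second inequality could fail.
\<close>

lemma beatty_cover:
  fixes \<alpha> \<beta> :: real
  assumes "0 < \<alpha>" "0 < \<beta>" "\<alpha> \<notin> \<rat>" "\<beta> \<notin> \<rat>" "1 / \<alpha> + 1 / \<beta> = 1" "m \<ge> 1"
  obtains n where "n \<ge> 1" "int m = \<lfloor>real n * \<alpha>\<rfloor>" | n where "n \<ge> 1" "int m = \<lfloor>real n * \<beta>\<rfloor>"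
proof -
  have bracket: "\<exists>n::nat. real n < m * (1 / x) \<and> (m + 1) * (1 / x) < real n + 1"
    if "0 < x" "x \<notin> \<rat>" and missed: "\<And>n. n \<ge> 1 \<Longrightarrow> int m \<noteq> \<lfloor>real n * x\<rfloor>" for x
  proof -
    \<comment> \<open>This is the last index with \<open>n * x \<le> m + 1\<close>; as \<open>m\<close> is missed and \<open>m + 1\<close> is not a multiple
      of \<open>x\<close>, even \<open>n * x < m\<close>.\<close>
    define n where "n = nat \<lfloor>(m + 1) / x\<rfloor>"
    have n: "real n \<le> (m + 1) / x" "(m + 1) / x < real n + 1"
      using \<open>0 < x\<close> unfolding n_def by auto
    then have le: "real n * x \<le> m + 1" using \<open>0 < x\<close> by (simp add: field_simps)
    have "real n * x < m"
    proof (cases "n = 0")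
      case True
      then show ?thesis using \<open>m \<ge> 1\<close> by simp
    next
      case False
      then have "n \<ge> 1" by simp
      then show ?thesis
        using irrational_multiple_neq_int[OF \<open>x \<notin> \<rat>\<close> \<open>n \<ge> 1\<close>, of "int m + 1"] missed[OF \<open>n \<ge> 1\<close>] le
        by (simp add: eq_commute[of "int m"] floor_eq_iff)
    qed
    then show ?thesis using n(2) \<open>0 < x\<close> by (intro exI[of _ n]) (simp add: field_simps)
  qed
  have "\<not> ((\<forall>n\<ge>1. int m \<noteq> \<lfloor>real n * \<alpha>\<rfloor>) \<and> (\<forall>n\<ge>1. int m \<noteq> \<lfloor>real n * \<beta>\<rfloor>))"
  proof
    assume "(\<forall>n\<ge>1. int m \<noteq> \<lfloor>real n * \<alpha>\<rfloor>) \<and> (\<forall>n\<ge>1. int m \<noteq> \<lfloor>real n * \<beta>\<rfloor>)"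
    then obtain n k :: nat where
      "real n < m * (1 / \<alpha>)" "(m + 1) * (1 / \<alpha>) < real n + 1"
      "real k < m * (1 / \<beta>)" "(m + 1) * (1 / \<beta>) < real k + 1"
      using bracket[of \<alpha>] bracket[of \<beta>] assms(1-4) by blast
    then have "real n + real k < m * (1 / \<alpha> + 1 / \<beta>)"
      "(m + 1) * (1 / \<alpha> + 1 / \<beta>) < real n + real k + 2"
      by (simp_all only: distrib_left)
    then have "real (n + k) < real m" "real (m + 1) < real (n + k + 2)"
      unfolding assms(5) by simp_all
    then show False unfolding of_nat_less_iff by linarith
  qed
  then show thesis using that by blast
qed

section \<open>The kernel of the Beatty game\<close>

locale beatty_game =
  fixes \<alpha> \<beta> :: real
  assumes alpha_gt_1: "1 < \<alpha>" and alpha_less: "\<alpha> < 5 / 4" and alpha_irrational: "\<alpha> \<notin> \<rat>"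
    and complementary: "1 / \<alpha> + 1 / \<beta> = 1"
begin

definition a :: "nat \<Rightarrow> nat" where "a n = nat \<lfloor>real n * \<alpha>\<rfloor>"
definition b :: "nat \<Rightarrow> nat" where "b n = nat \<lfloor>real n * \<beta>\<rfloor>"
definition d :: "nat \<Rightarrow> int" where "d n = int (b n) - int (a n)"

lemma inverse_beta: "1 / \<beta> = 1 - 1 / \<alpha>"
  using complementary by simp

lemma beta_gt_5: "5 < \<beta>"
proof -
  have "0 < 1 / \<beta>" "1 / \<beta> < 1 / 5"
    using alpha_gt_1 alpha_less unfolding inverse_beta by (simp_all add: field_simps)
  then show ?thesis by (simp add: field_simps zero_less_divide_iff split: if_splits)
qed

lemma beta_irrational: "\<beta> \<notin> \<rat>"
proof
  assume "\<beta> \<in> \<rat>"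
  then have "1 / (1 - 1 / \<beta>) \<in> \<rat>" by simp
  moreover have "1 / (1 - 1 / \<beta>) = \<alpha>" unfolding inverse_beta by simp
  ultimately show False using alpha_irrational by simp
qed

lemma int_a: "int (a n) = \<lfloor>real n * \<alpha>\<rfloor>" and int_b: "int (b n) = \<lfloor>real n * \<beta>\<rfloor>"
  using alpha_gt_1 beta_gt_5 by (simp_all add: a_def b_def)

lemma zero_terms [simp]: "a 0 = 0" "b 0 = 0" "d 0 = 0"
  by (simp_all add: a_def b_def d_def)

lemma a_step: "a n + 1 \<le> a (Suc n)" "a (Suc n) \<le> a n + 2"
proof -
  have "\<lfloor>\<alpha>\<rfloor> = 1" using alpha_gt_1 alpha_less by linarith
  then show "a n + 1 \<le> a (Suc n)" "a (Suc n) \<le> a n + 2"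
    using floor_multiple_step[where x = \<alpha> and n = n] int_a[of n] int_a[of "Suc n"] by linarith+
qed

lemma b_step: "int (b n) + \<lfloor>\<beta>\<rfloor> \<le> int (b (Suc n))" "int (b (Suc n)) \<le> int (b n) + \<lfloor>\<beta>\<rfloor> + 1"
  using floor_multiple_step[where x = \<beta> and n = n] int_b[of n] int_b[of "Suc n"] by linarith+

lemma floor_beta_ge: "5 \<le> \<lfloor>\<beta>\<rfloor>"
  using beta_gt_5 by linarith

lemma d_step: "d n + 3 \<le> d (Suc n)"
  using a_step[of n] b_step[of n] floor_beta_ge unfolding d_def by linarith

lemma strict_mono_a: "strict_mono a"
  using a_step(1) by (simp add: strict_mono_Suc_iff Suc_le_eq)

lemma strict_mono_b: "strict_mono b"
proof -
  have "b n < b (Suc n)" for n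
    using b_step(1)[of n] floor_beta_ge by linarith
  then show ?thesis by (simp add: strict_mono_Suc_iff)
qed

lemma strict_mono_d: "strict_mono d"
proof -
  have "d n < d (Suc n)" for n
    using d_step[of n] by linarith
  then show ?thesis by (simp add: strict_mono_Suc_iff)
qed

lemma a_eq_iff: "a m = a n \<longleftrightarrow> m = n"
  using strict_mono_a by (rule strict_mono_eq)

lemma b_eq_iff: "b m = b n \<longleftrightarrow> m = n"
  using strict_mono_b by (rule strict_mono_eq)

lemma a_less_iff: "a m < a n \<longleftrightarrow> m < n"
  using strict_mono_a by (rule strict_mono_less)

lemma a_le_b: "a n \<le> b n"
  using strict_mono_mono[OF strict_mono_d] monoD[of d 0 n] unfolding d_def by simp

lemma a_less_b: "a n < b n" if "n \<ge> 1"
  using strict_mono_less[OF strict_mono_d, of 0 n] that unfolding d_def by simp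

lemma a_eq_b_iff: "a n = b k \<longleftrightarrow> n = 0 \<and> k = 0"
proof -
  consider "n \<ge> 1" "k \<ge> 1" | "n = 0" | "k = 0" by fastforce
  then show ?thesis
  proof cases
    case 1
    then have "int (a n) \<noteq> int (b k)"
      using beatty_disjoint[of \<alpha> \<beta> n k] alpha_gt_1 beta_gt_5 alpha_irrational beta_irrational
        complementary unfolding int_a int_b by simp
    then show ?thesis using 1 by simp
  next
    case 2
    then show ?thesis using b_eq_iff[of 0 k] by auto
  next
    case 3
    then show ?thesis using a_eq_iff[of n 0] by auto
  qed
qed

lemma nat_cover:
  obtains n where "x = a n" | n where "n \<ge> 1" "x = b n"
proof (cases "x = 0")
  case True
  then show ?thesis using that(1)[of 0] by simp
next
  case False
  then have "x \<ge> 1" by simp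
  then consider n where "int x = \<lfloor>real n * \<alpha>\<rfloor>" | n where "n \<ge> 1" "int x = \<lfloor>real n * \<beta>\<rfloor>"
    using beatty_cover[of \<alpha> \<beta> x] alpha_gt_1 beta_gt_5 alpha_irrational beta_irrational
      complementary by (metis less_trans zero_less_one zero_less_numeral)
  then show ?thesis
    by cases (metis int_a int_b of_nat_eq_iff that)+
qed

text \<open>
  The constraint is the gap between consecutive differences of the piles, so moving from a pair to
  the previous one violates it just barely. The description in the definition is proper because
  \<open>a (Suc n)\<close> determines its index, by monotonicity and Beatty's theorem.
\<close>

lemma constraint_a: "beatty_constraint \<alpha> \<beta> (a (Suc n)) = d (Suc n) - d n"
proof -
  let ?v = "\<lambda>k. (\<lfloor>real k * \<beta>\<rfloor> - \<lfloor>(real k - 1) * \<beta>\<rfloor>) - (\<lfloor>real k * \<alpha>\<rfloor> - \<lfloor>(real k - 1) * \<alpha>\<rfloor>)"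
  have index: "k \<ge> 1 \<and> (int (a (Suc n)) = \<lfloor>real k * \<alpha>\<rfloor> \<or> int (a (Suc n)) = \<lfloor>real k * \<beta>\<rfloor>)
      \<longleftrightarrow> k = Suc n" for k
    unfolding int_a[of k, symmetric] int_b[of k, symmetric] of_nat_eq_iff
    by (auto simp: a_eq_iff a_eq_b_iff)
  have "beatty_constraint \<alpha> \<beta> (a (Suc n)) = ?v (Suc n)"
    unfolding beatty_constraint_def conj_assoc[symmetric] index by simp
  also have "\<dots> = d (Suc n) - d n"
    using int_a[of n] int_a[of "Suc n"] int_b[of n] int_b[of "Suc n"] unfolding d_def by simp
  finally show ?thesis .
qed

lemma kernel_independent:
  assumes "move (beatty_constraint \<alpha> \<beta>) (a n, b n) q"
  shows "q \<noteq> (a m, b m)"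
proof
  assume q: "q = (a m, b m)"
  from assms show False
  proof cases
    case (smaller k)
    then have "b n = a m \<or> b n = b m" "n \<noteq> 0"
      using q by (auto simp: listed_def min_def max_def intro: Nat.gr0I split: if_splits)
    then have "m = n" using a_eq_b_iff[of m n] b_eq_iff by auto
    then show False using smaller q move_decreases[OF assms] by simp
  next
    case (larger k)
    then have "a n = a m \<or> a n = b m" "n \<noteq> 0"
      using q by (auto simp: listed_def min_def max_def intro: Nat.gr0I split: if_splits)
    then have "m = n" using a_eq_b_iff[of n m] a_eq_iff by auto
    then show False using larger q move_decreases[OF assms] by simp
  next
    case (both x1 y1)
    then have "a m < a n" using q by auto
    then have "m < n" using a_less_iff by simp
    then obtain l where l: "n = Suc l" "m \<le> l" by (cases n) auto
    have "d m \<le> d l" "d l < d n"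
      using strict_mono_d l by (simp_all add: strict_mono_less_eq strict_mono_less)
    moreover have "\<bar>d n - d m\<bar> < d n - d l"
      using both q constraint_a[of l] l unfolding d_def by (simp add: algebra_simps)
    ultimately show False by linarith
  qed
qed

text \<open>
  The target is one of the two pairs whose differences enclose \<open>y - a n\<close>: the lower one unless its
  difference is too far away, in which case the upper one is close enough and its larger
  pile still does not exceed \<open>y\<close>.
\<close>

lemma reach_kernel_below:
  assumes "a n \<le> y" "y < b n"
  shows "\<exists>k. move (beatty_constraint \<alpha> \<beta>) (a n, y) (a k, b k)"
proof -
  define e where "e = int y - int (a n)"
  have e: "0 \<le> e" "e < d n" using assms unfolding e_def d_def by simp_all
  have "\<exists>m<n. d m \<le> e \<and> e < d (Suc m)"
  proof -
    define N where "N = (LEAST k. e < d k)"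
    have "e < d N" and "N \<le> n"
      using e(2) unfolding N_def by (auto intro: LeastI Least_le)
    with e(1) obtain m where m: "N = Suc m" by (cases N) auto
    then have "\<not> e < d m" using not_less_Least[of m "\<lambda>k. e < d k"] by (simp add: N_def)
    then show ?thesis using m \<open>e < d N\<close> \<open>N \<le> n\<close> by (intro exI[of _ m]) auto
  qed
  then obtain m where m: "m < n" "d m \<le> e" "e < d (Suc m)" by blast
  then obtain l where l: "n = Suc l" "m \<le> l" by (cases n) auto
  let ?c = "beatty_constraint \<alpha> \<beta> (a n)"
  have c: "?c = d n - d l" using constraint_a[of l] l by simp
  show ?thesis
  proof (cases "e - d m < ?c")
    case True
    have "a m < a n" using a_less_iff m(1) by simp
    then have "move (beatty_constraint \<alpha> \<beta>) (a n, y) (a m, b m)"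
      using True m(2) assms(1) a_le_b[of m] by (intro move.both) (auto simp: e_def d_def)
    then show ?thesis by blast
  next
    case False
    \<comment> \<open>If \<open>e\<close> lay in the last gap, \<open>e - d m\<close> would be less than its length, which is \<open>?c\<close>.\<close>
    have "m \<noteq> l" using False m(3) c l(1) by auto
    then have "Suc m < n" using l by simp
    then have a_less: "a (Suc m) < a n" using a_less_iff by simp
    have "a (Suc m) \<le> a l" using strict_mono_a l \<open>m \<noteq> l\<close> by (simp add: strict_mono_less_eq)
    \<comment> \<open>The gap of \<open>d\<close> around \<open>e\<close> is at most \<open>\<lfloor>\<beta>\<rfloor>\<close>, and \<open>?c\<close> is at least \<open>\<lfloor>\<beta>\<rfloor>\<close> minus the last gap
      of \<open>a\<close>; so what is missing above \<open>e\<close> is at most that last gap.\<close>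
    have short: "d (Suc m) - e \<le> int (a n) - int (a l)"
      using False c a_step(1)[of m] b_step(2)[of m] b_step(1)[of l, folded l(1)] unfolding d_def by linarith
    have "d (Suc m) - e \<le> 2" using short a_step(2)[of l, folded l(1)] by linarith
    then have small: "d (Suc m) - e < ?c" using c d_step[of l] l(1) by simp
    have le: "b (Suc m) \<le> y"
      using short \<open>a (Suc m) \<le> a l\<close> unfolding d_def e_def by linarith
    have "move (beatty_constraint \<alpha> \<beta>) (a n, y) (a (Suc m), b (Suc m))"
    proof (cases "b (Suc m) = y")
      case True
      then have "listed (a n - (a n - a (Suc m))) y = (a (Suc m), b (Suc m))"
        using a_less a_le_b[of "Suc m"] by (simp add: listed_def)
      then show ?thesis
        using move.smaller[of "a n" y "a n - a (Suc m)"] a_less assms(1) by simp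
    next
      case False
      then show ?thesis
        using le a_less small m(3) assms(1) a_le_b[of "Suc m"]
        by (intro move.both) (auto simp: e_def d_def)
    qed
    then show ?thesis by blast
  qed
qed

lemma kernel_absorbing:
  assumes "x \<le> y" "\<And>n. (x, y) \<noteq> (a n, b n)"
  shows "\<exists>k. move (beatty_constraint \<alpha> \<beta>) (x, y) (a k, b k)"
proof (cases x rule: nat_cover)
  case (1 n)
  consider "y < b n" | "b n < y" using assms(2)[of n] 1 by force
  then show ?thesis
  proof cases
    case 1
    then show ?thesis using reach_kernel_below \<open>x = a n\<close> assms(1) by simp
  next
    case 2
    have "listed x (y - (y - b n)) = (a n, b n)"
      using 2 a_le_b[of n] \<open>x = a n\<close> by (simp add: listed_def)
    then show ?thesis
      using move.larger[of x y "y - b n"] 2 assms(1) by (intro exI[of _ n]) simp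
  qed
next
  case (2 n)
  have "a n < y" using a_less_b[of n] 2 assms(1) by simp
  moreover have "listed x (y - (y - a n)) = (a n, b n)"
    using \<open>a n < y\<close> a_le_b[of n] 2 by (simp add: listed_def)
  ultimately show ?thesis
    using move.larger[of x y "y - a n"] assms(1) by (intro exI[of _ n]) simp
qed

lemma P_positions: "{p. P_position (beatty_constraint \<alpha> \<beta>) p} = {(a n, b n) | n. True}"
proof (rule P_positions_eq_kernel)
  fix p assume "is_position p" "p \<notin> {(a n, b n) | n. True}"
  then show "\<exists>q\<in>{(a n, b n) | n. True}. move (beatty_constraint \<alpha> \<beta>) p q"
    using kernel_absorbing[of "fst p" "snd p"] by (cases p) (auto simp: is_position_def)
next
  fix p q assume "p \<in> {(a n, b n) | n. True}" "move (beatty_constraint \<alpha> \<beta>) p q"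
  then show "q \<notin> {(a n, b n) | n. True}"
    using kernel_independent by blast
qed (use a_le_b in \<open>auto simp: is_position_def\<close>)

end

theorem lemma6:
  fixes \<alpha> \<beta> :: real
  assumes "1 < \<alpha>" and "\<alpha> < 5 / 4" and "\<alpha> \<notin> \<rat>"
    and "1 / \<alpha> + 1 / \<beta> = 1"
  shows "{p. P_position (beatty_constraint \<alpha> \<beta>) p} =
         {(nat \<lfloor>real n * \<alpha>\<rfloor>, nat \<lfloor>real n * \<beta>\<rfloor>) | n :: nat. True}"
proof -
  interpret beatty_game \<alpha> \<beta> using assms by unfold_locales
  show ?thesis using P_positions unfolding a_def b_def .
qed

end
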